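(* Let $\{p_n\}_{n\ge0}$ be orthogonal polynomials with respect to the inner product $\langle f,g\rangle=\int_{\mathbb{R}}f(x)g(x)\,d\mu(x)$, and let $X$ be the operator $(Xf)(x)=xf(x)$ on $\mathbb{R}[x]$. Let $L$ be a linear operator on $\mathbb{R}[x]$ which is skew symmetric, i.e. $\langle Lf,g\rangle=-\langle f,Lg\rangle$ for all $f,g\in\mathbb{R}[x]$, and such that $L(x^n)=\gamma_nx^{n+1}+\text{terms of lower degree}$ with $\gamma_n\ne0$, for all $n\ge0$. Define a linear operator $D$ on $\mathbb{R}[x]$ by its action on monomials: $$D(1)=0,\qquad D(x^n)=\sum_{k=0}^{n-1}X^kL(x^{n-k-1})\quad(n\ge1).$$ Then: (i) $D$ is symmetric, i.e. $\langle Df,g\rangle=\langle f,Dg\rangle$ for all $f,g\in\mathbb{R}[x]$; there are real numbers $\lambda_n$ with $\lambda_0=0$ and $\lambda_{n+1}-\lambda_n=\gamma_n\neq0$ such that $D(x^n)=\lambda_nx^n+\text{terms of lower degree}$ for all $n\ge0$; $Dp_n=\lambda_np_n$ for all $n\ge 0$; and $L=[D,X]=DX-XD$. (ii) Any other linear operator $D'$ on $\mathbb{R}[x]$ satisfying $L=D'X-XD'$ and having the constant polynomial $1$ as eigenfunction differs from $D$ by a constant times the identity.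
   Context: $\mu$ is an orthogonality measure on $\mathbb{R}$ (a positive measure with infinite support and all moments finite), and $p_n\in\mathbb{R}[x]$ satisfy $p_n(x)=k_nx^n+\cdots$ with $k_n\ne0$ and $\langle p_n,p_m\rangle=h_n\delta_{n,m}$. *)

theory Defs
  imports "HOL-Analysis.Analysis" "HOL-Computational_Algebra.Polynomial"
begin

text \<open>The topological support of a Borel measure on the real line.\<close>

definition measure_support :: "real measure \<Rightarrow> real set" where
  "measure_support \<mu> = {x. \<forall>U. open U \<longrightarrow> x \<in> U \<longrightarrow> emeasure \<mu> U \<noteq> 0}"

definition orthogonality_measure :: "real measure \<Rightarrow> bool" where
  "orthogonality_measure \<mu> \<longleftrightarrow>
     sets \<mu> = sets borel \<and> infinite (measure_support \<mu>) \<and> (\<forall>n::nat. integrable \<mu> (\<lambda>x. x ^ n))"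

definition inner_poly :: "real measure \<Rightarrow> real poly \<Rightarrow> real poly \<Rightarrow> real" where
  "inner_poly \<mu> f g = (\<integral>x. poly f x * poly g x \<partial>\<mu>)"

text \<open>\<open>f = c x\<^sup>n + terms of lower degree\<close>.  Here \<open>c = 0\<close> is allowed, and for \<open>n = 0\<close> there are
  no lower terms, so \<open>f\<close> is the constant \<open>c\<close>.\<close>

definition leading_form :: "real poly \<Rightarrow> real \<Rightarrow> nat \<Rightarrow> bool" where
  "leading_form f c n \<longleftrightarrow> (\<exists>r. f = monom c n + r \<and> (r = 0 \<or> degree r < n))"

definition orthogonal_polynomials ::
  "real measure \<Rightarrow> (nat \<Rightarrow> real poly) \<Rightarrow> (nat \<Rightarrow> real) \<Rightarrow> (nat \<Rightarrow> real) \<Rightarrow> bool" where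
  "orthogonal_polynomials \<mu> p k h \<longleftrightarrow>
     (\<forall>n. k n \<noteq> 0 \<and> leading_form (p n) (k n) n) \<and>
     (\<forall>n m. inner_poly \<mu> (p n) (p m) = (if n = m then h n else 0))"

abbreviation linear_op :: "(real poly \<Rightarrow> real poly) \<Rightarrow> bool" where
  "linear_op \<equiv> Vector_Spaces.linear smult smult"

definition symmetric_op :: "real measure \<Rightarrow> (real poly \<Rightarrow> real poly) \<Rightarrow> bool" where
  "symmetric_op \<mu> T \<longleftrightarrow> (\<forall>f g. inner_poly \<mu> (T f) g = inner_poly \<mu> f (T g))"

definition skew_symmetric_op :: "real measure \<Rightarrow> (real poly \<Rightarrow> real poly) \<Rightarrow> bool" where
  "skew_symmetric_op \<mu> T \<longleftrightarrow> (\<forall>f g. inner_poly \<mu> (T f) g = - inner_poly \<mu> f (T g))"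

definition X_op :: "real poly \<Rightarrow> real poly" where
  "X_op f = [:0, 1:] * f"

definition commutator_op ::
  "(real poly \<Rightarrow> real poly) \<Rightarrow> (real poly \<Rightarrow> real poly) \<Rightarrow> real poly \<Rightarrow> real poly" where
  "commutator_op A B f = A (B f) - B (A f)"

definition eigenfunction_op :: "(real poly \<Rightarrow> real poly) \<Rightarrow> real poly \<Rightarrow> bool" where
  "eigenfunction_op T f \<longleftrightarrow> f \<noteq> 0 \<and> (\<exists>c. T f = smult c f)"

definition D_monom :: "(real poly \<Rightarrow> real poly) \<Rightarrow> nat \<Rightarrow> real poly" where
  "D_monom L n = (\<Sum>k<n. (X_op ^^ k) (L (monom 1 (n - k - 1))))"

text \<open>The linear extension from the monomials; \<open>linear_op_D_op\<close>, \<open>D_op_one\<close> and \<open>D_op_monom\<close> below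
  are its defining properties, and \<open>D_op_unique\<close> shows that they determine it.\<close>

definition D_op :: "(real poly \<Rightarrow> real poly) \<Rightarrow> real poly \<Rightarrow> real poly" where
  "D_op L f = (\<Sum>i\<le>degree f. smult (coeff f i) (D_monom L i))"

lemma D_op_eq:
  assumes "degree f \<le> N"
  shows "D_op L f = (\<Sum>i\<le>N. smult (coeff f i) (D_monom L i))"
  unfolding D_op_def
  by (rule sum.mono_neutral_left) (use assms in \<open>auto simp: coeff_eq_0\<close>)

lemma vector_space_smult: "vector_space (smult :: real \<Rightarrow> real poly \<Rightarrow> real poly)"
  by unfold_locales (auto simp: smult_add_right smult_add_left)

lemma linear_op_iff:
  "linear_op T \<longleftrightarrow> (\<forall>f g. T (f + g) = T f + T g) \<and> (\<forall>c f. T (smult c f) = smult c (T f))"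
  using vector_space_smult
  by (simp add: Vector_Spaces.linear_def module_hom_def module_hom_axioms_def
      vector_space_def module_def)

lemma linear_op_D_op: "linear_op (D_op L)"
  unfolding linear_op_iff
proof (intro conjI allI)
  fix f g :: "real poly"
  let ?N = "max (degree f) (degree g)"
  have "degree (f + g) \<le> ?N" by (rule degree_add_le_max)
  then show "D_op L (f + g) = D_op L f + D_op L g"
    by (simp add: D_op_eq[where N = ?N] smult_add_left sum.distrib)
next
  fix c and f :: "real poly"
  have "smult c (\<Sum>i\<le>n. F i) = (\<Sum>i\<le>n. smult c (F i))" for n and F :: "nat \<Rightarrow> real poly"
    by (induction n) (auto simp: smult_add_right)
  moreover have "degree (smult c f) \<le> degree f" by (rule degree_smult_le)
  ultimately show "D_op L (smult c f) = smult c (D_op L f)"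
    by (simp add: D_op_eq[where N = "degree f"])
qed

lemma D_op_monom_gen: "D_op L (monom 1 n) = D_monom L n"
proof -
  have "D_op L (monom 1 n) = (\<Sum>i\<le>n. if i = n then D_monom L n else 0)"
    unfolding D_op_eq[of "monom 1 n" n L, OF degree_monom_le] by (rule sum.cong) auto
  then show ?thesis by simp
qed

lemma D_op_one: "D_op L 1 = 0"
  using D_op_monom_gen[of L 0] by (simp add: D_monom_def)

lemma D_op_monom:
  assumes "n \<ge> 1"
  shows "D_op L (monom 1 n) = (\<Sum>k=0..n-1. (X_op ^^ k) (L (monom 1 (n - k - 1))))"
proof -
  have "{..<n} = {0..n-1}" using assms by auto
  then show ?thesis by (simp add: D_op_monom_gen D_monom_def)
qed

lemma D_op_unique:
  assumes lin: "linear_op T" and one: "T 1 = 0"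
    and mon: "\<And>n. n \<ge> 1 \<Longrightarrow> T (monom 1 n) = (\<Sum>k=0..n-1. (X_op ^^ k) (L (monom 1 (n - k - 1))))"
  shows "T = D_op L"
proof
  fix f :: "real poly"
  have add: "S (\<Sum>i\<le>n. smult (c i) (F i)) = (\<Sum>i\<le>n. smult (c i) (S (F i)))"
    if "linear_op S" for S c n and F :: "nat \<Rightarrow> real poly"
    using that unfolding linear_op_iff by (induction n) auto
  have eq: "T (monom 1 i) = D_op L (monom 1 i)" for i
    using mon[of i] D_op_monom[of i L] one by (cases "i = 0") (auto simp: D_op_one)
  have f: "f = (\<Sum>i\<le>degree f. smult (coeff f i) (monom 1 i))"
    by (simp add: smult_monom poly_as_sum_of_monoms)
  show "T f = D_op L f"
    by (subst (1 2) f) (simp only: add[OF lin] add[OF linear_op_D_op] eq)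
qed

end

theory Submission
  imports Defs
begin

text \<open>The defining formula gives \<open>D x\<^sup>n\<^sup>+\<^sup>1 = L x\<^sup>n + X D x\<^sup>n\<close>, hence \<open>L = [D, X]\<close>. Put
  \<open>B(f, g) = \<langle>D f, g\<rangle> - \<langle>f, D g\<rangle>\<close>. Skew symmetry of \<open>L\<close> and \<open>L = [D, X]\<close> give
  \<open>B(X f, g) = B(f, X g)\<close>, so \<open>B(x\<^sup>m, x\<^sup>n)\<close> depends only on \<open>m + n\<close>; as \<open>B\<close> is antisymmetric, it
  vanishes. Since \<open>D\<close> is triangular on the monomials, \<open>D p\<^sub>n - \<lambda>\<^sub>n p\<^sub>n\<close> has degree below \<open>n\<close>; by
  symmetry of \<open>D\<close> it is orthogonal to all polynomials of degree below \<open>n\<close>, hence to itself,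
  and the inner product is definite because the support of \<open>\<mu>\<close> is infinite.\<close>

section \<open>Leading forms and linear operators\<close>

text \<open>Trades the hidden remainder for a degree bound and one coefficient. The bound is not
  strict because \<open>c = 0\<close> is allowed, in which case the degree drops.\<close>

lemma leading_form_iff: "leading_form f c n \<longleftrightarrow> degree f \<le> n \<and> coeff f n = c"
proof
  assume "leading_form f c n"
  then obtain r where f: "f = monom c n + r" and r: "r = 0 \<or> degree r < n"
    unfolding leading_form_def by blast
  then have "degree r \<le> n" "coeff r n = 0"
    by (auto simp: coeff_eq_0)
  then show "degree f \<le> n \<and> coeff f n = c"
    unfolding f by (auto intro!: degree_add_le degree_monom_le)
next
  assume *: "degree f \<le> n \<and> coeff f n = c"
  define r where "r = f - monom c n"
  have "degree r \<le> n" "coeff r n = 0"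
    using * by (auto simp: r_def intro!: degree_diff_le degree_monom_le)
  then have "r = 0 \<or> degree r < n"
    by (metis le_neq_implies_less leading_coeff_0_iff)
  then show "leading_form f c n"
    unfolding leading_form_def by (intro exI[of _ r]) (simp add: r_def)
qed

text \<open>Monomials span the polynomials, so an identity linear in \<open>f\<close> need only be
  checked on monomials.\<close>

lemma poly_linear_induct [case_names monom add smult]:
  fixes f :: "'a::comm_semiring_1 poly"
  assumes monom: "\<And>n. P (monom 1 n)"
    and add: "\<And>f g. P f \<Longrightarrow> P g \<Longrightarrow> P (f + g)"
    and smult: "\<And>c f. P f \<Longrightarrow> P (smult c f)"
  shows "P f"
proof -
  have m: "P (Polynomial.monom c n)" for c n
    using smult[OF monom, of c n] by (simp add: smult_monom)
  have "P (\<Sum>i\<le>N. Polynomial.monom (coeff f i) i)" for N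
    by (induction N) (auto intro: add m)
  from this[of "degree f"] show ?thesis
    by (simp add: poly_as_sum_of_monoms)
qed

lemma X_op_monom: "X_op (monom c n) = monom c (Suc n)"
  by (simp add: X_op_def monom_Suc)

lemma X_op_add: "X_op (f + g) = X_op f + X_op g"
  by (simp add: X_op_def algebra_simps)

lemma X_op_smult: "X_op (smult c f) = smult c (X_op f)"
  by (simp add: X_op_def)

lemma X_op_sum: "X_op (sum F A) = (\<Sum>i\<in>A. X_op (F i))"
  by (simp add: X_op_def sum_distrib_left)

lemma linear_op_add: "linear_op T \<Longrightarrow> T (f + g) = T f + T g"
  and linear_op_smult: "linear_op T \<Longrightarrow> T (smult c f) = smult c (T f)"
  by (auto simp: linear_op_iff)

lemma linear_op_eqI:
  assumes "linear_op S" "linear_op T" "\<And>n. S (monom 1 n) = T (monom 1 n)"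
  shows "S = T"
proof
  fix f
  show "S f = T f"
    by (induction f rule: poly_linear_induct)
      (simp_all add: assms linear_op_add linear_op_smult)
qed

section \<open>Commutator with multiplication by x, and triangularity\<close>

lemma linear_op_commutator_X:
  assumes "linear_op T"
  shows "linear_op (commutator_op T X_op)"
  unfolding linear_op_iff commutator_op_def
  by (simp add: X_op_add X_op_smult linear_op_add[OF assms] linear_op_smult[OF assms]
      smult_diff_right)

text \<open>The term \<open>k = 0\<close> of the sum is split off; the other terms share a factor
  \<open>X_op\<close>.\<close>

lemma D_monom_Suc: "D_monom L (Suc n) = L (monom 1 n) + X_op (D_monom L n)"
  unfolding D_monom_def sum.lessThan_Suc_shift X_op_sum by simp

lemma commutator_D_op:
  assumes "linear_op L"
  shows "commutator_op (D_op L) X_op = L"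
  using linear_op_commutator_X[OF linear_op_D_op] assms
  by (rule linear_op_eqI) (simp add: commutator_op_def X_op_monom D_op_monom_gen D_monom_Suc)

text \<open>By \<open>D_monom_Suc\<close>, multiplication by x keeps the leading coefficient and
  raises the degree by one, while \<open>L\<close> contributes a further \<open>\<gamma> n\<close>;
  so the coefficients are partial sums.\<close>

lemma leading_form_D_monom:
  assumes "\<And>n. leading_form (L (monom 1 n)) (\<gamma> n) (Suc n)"
  shows "leading_form (D_monom L n) (\<Sum>i<n. \<gamma> i) n"
proof (induction n)
  case 0
  show ?case by (simp add: D_monom_def leading_form_iff)
next
  case (Suc n)
  then show ?case
    using assms[of n] unfolding leading_form_iff D_monom_Suc X_op_def
    by (auto intro!: degree_add_le order.trans[OF degree_pCons_le])
qed

text \<open>Only the term \<open>i = n\<close> reaches degree \<open>n\<close>. Stating this for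
  every bound \<open>n\<close> on the degree shows at once that the operator raises no
  degree.\<close>

lemma leading_form_D_op:
  assumes "\<And>n. leading_form (D_monom L n) (l n) n" and "degree f \<le> n"
  shows "leading_form (D_op L f) (l n * coeff f n) n"
proof -
  have deg: "degree (D_monom L i) \<le> i" and co: "coeff (D_monom L i) i = l i" for i
    using assms(1) by (auto simp: leading_form_iff)
  have "degree (D_op L f) \<le> n"
    unfolding D_op_eq[OF assms(2)]
    by (intro degree_sum_le) (auto intro: order.trans[OF degree_smult_le] order.trans[OF deg])
  moreover have "coeff (D_op L f) n = (\<Sum>i\<le>n. if i = n then l n * coeff f n else 0)"
    unfolding D_op_eq[OF assms(2)] coeff_sum
    by (intro sum.cong) (auto simp: co coeff_eq_0 le_less_trans[OF deg])
  ultimately show ?thesis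
    by (simp add: leading_form_iff)
qed

section \<open>The inner product and its definiteness\<close>

lemma integrable_poly_mult:
  assumes "orthogonality_measure \<mu>"
  shows "integrable \<mu> (\<lambda>x. poly f x * poly g x)"
proof -
  have "integrable \<mu> (\<lambda>x. poly (f * g) x)"
    using assms unfolding orthogonality_measure_def poly_altdef
    by (auto intro!: Bochner_Integration.integrable_sum)
  then show ?thesis by simp
qed

lemma inner_poly_commute: "inner_poly \<mu> f g = inner_poly \<mu> g f"
  by (simp add: inner_poly_def mult.commute)

lemma inner_poly_X: "inner_poly \<mu> (X_op f) g = inner_poly \<mu> f (X_op g)"
  by (simp add: inner_poly_def X_op_def mult_ac)

lemma inner_poly_smult_left: "inner_poly \<mu> (smult c f) g = c * inner_poly \<mu> f g"
  by (simp add: inner_poly_def mult.assoc)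

lemma inner_poly_smult_right: "inner_poly \<mu> f (smult c g) = c * inner_poly \<mu> f g"
  by (simp add: inner_poly_smult_left inner_poly_commute[of _ f])

lemma inner_poly_zero_right: "inner_poly \<mu> f 0 = 0"
  by (simp add: inner_poly_def)

context
  fixes \<mu> :: "real measure"
  assumes \<mu>: "orthogonality_measure \<mu>"
begin

lemma inner_poly_add_left: "inner_poly \<mu> (f + g) q = inner_poly \<mu> f q + inner_poly \<mu> g q"
  by (simp add: inner_poly_def distrib_right integrable_poly_mult[OF \<mu>])

lemma inner_poly_add_right: "inner_poly \<mu> q (f + g) = inner_poly \<mu> q f + inner_poly \<mu> q g"
  by (simp add: inner_poly_add_left inner_poly_commute[of _ q])

lemma inner_poly_diff_left: "inner_poly \<mu> (f - g) q = inner_poly \<mu> f q - inner_poly \<mu> g q"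
  using inner_poly_add_left[of "f - g" g q] by simp

text \<open>A nonnegative integrand with integral zero vanishes almost everywhere. If
  \<open>f\<close> were nonzero, the open set where it does not vanish would be null, so the
  infinite support would lie in the finite set of roots.\<close>

lemma inner_poly_self_eq_0D:
  assumes "inner_poly \<mu> f f = 0"
  shows "f = 0"
proof (rule ccontr)
  assume "f \<noteq> 0"
  have sets: "sets \<mu> = sets borel" and inf: "infinite (measure_support \<mu>)"
    using \<mu> by (auto simp: orthogonality_measure_def)
  have "integrable \<mu> (\<lambda>x. poly f x * poly f x)"
    by (rule integrable_poly_mult[OF \<mu>])
  then have ae: "AE x in \<mu>. poly f x = 0"
    using assms by (subst (asm) inner_poly_def, subst (asm) integral_nonneg_eq_0_iff_AE) auto
  let ?U = "{x. poly f x \<noteq> 0}"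
  have "open ?U"
    by (intro open_Collect_neq continuous_intros)
  then have "?U \<in> sets \<mu>"
    by (simp add: sets)
  then have "emeasure \<mu> ?U = 0"
    using ae sets_eq_imp_space_eq[OF sets] by (simp add: AE_iff_measurable[OF _ refl])
  with \<open>open ?U\<close> have "measure_support \<mu> \<subseteq> {x. poly f x = 0}"
    by (auto simp: measure_support_def)
  with inf poly_roots_finite[OF \<open>f \<noteq> 0\<close>] show False
    using finite_subset by blast
qed

section \<open>Symmetry from a skew commutator\<close>

lemma symmetric_opI_monom:
  assumes T: "linear_op T"
    and monom: "\<And>m n. inner_poly \<mu> (T (monom 1 m)) (monom 1 n)
                      = inner_poly \<mu> (monom 1 m) (T (monom 1 n))"
  shows "symmetric_op \<mu> T"
proof -
  note simps = linear_op_add[OF T] linear_op_smult[OF T] inner_poly_add_left inner_poly_add_right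
    inner_poly_smult_left inner_poly_smult_right
  have *: "inner_poly \<mu> (T (monom 1 m)) g = inner_poly \<mu> (monom 1 m) (T g)" for m g
    by (induction g rule: poly_linear_induct) (simp_all add: monom simps)
  have "inner_poly \<mu> (T f) g = inner_poly \<mu> f (T g)" for f g
    by (induction f rule: poly_linear_induct) (simp_all add: * simps)
  then show ?thesis
    by (simp add: symmetric_op_def)
qed

lemma symmetric_op_if_commutator_X_skew:
  assumes T: "linear_op T" and skew: "skew_symmetric_op \<mu> (commutator_op T X_op)"
  shows "symmetric_op \<mu> T"
proof (rule symmetric_opI_monom[OF T])
  define B where "B f g = inner_poly \<mu> (T f) g - inner_poly \<mu> f (T g)" for f g
  have anti: "B g f = - B f g" for f g
    by (simp add: B_def inner_poly_commute)
  have BX: "B (X_op f) g = B f (X_op g)" for f g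
  proof -
    have "inner_poly \<mu> (T (X_op f) - X_op (T f)) g = - inner_poly \<mu> f (T (X_op g) - X_op (T g))"
      using skew by (simp add: skew_symmetric_op_def commutator_op_def)
    \<comment> \<open>Moving \<open>X_op\<close> across the inner product turns \<langle>X T f,
      g\<rangle> into \<langle>T f, X g\<rangle> and \<langle>f, X T g\<rangle> into \<langle>X f, T
      g\<rangle>; the four terms then regroup into the two values of \<open>B\<close>.\<close>
    then show ?thesis
      by (simp add: B_def inner_poly_diff_left inner_poly_commute[of \<mu> f] inner_poly_X)
  qed
  have shift: "B (monom 1 m) (monom 1 n) = B (monom 1 0) (monom 1 (m + n))" for m n
    by (induction m arbitrary: n) (simp, metis BX X_op_monom add_Suc_shift)
  fix m n
  have "B (monom 1 m) (monom 1 n) = 0"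
    \<comment> \<open>Since m + n is unchanged by swapping m and n, \<open>B\<close> is symmetric on
      monomials as well as antisymmetric.\<close>
    using shift[of m n] shift[of n m] anti[of "monom 1 m" "monom 1 n"] by (simp add: add.commute)
  then show "inner_poly \<mu> (T (monom 1 m)) (monom 1 n) = inner_poly \<mu> (monom 1 m) (T (monom 1 n))"
    by (simp add: B_def)
qed

section \<open>Orthogonality to lower degrees and eigenfunctions\<close>

text \<open>Subtracting the multiple of \<open>p d\<close> that cancels the leading term of
  \<open>f\<close> lowers the degree, and \<open>p d\<close> is itself orthogonal to
  \<open>p n\<close> because \<open>d < n\<close>.\<close>

lemma orthogonal_lower_degree:
  assumes p: "orthogonal_polynomials \<mu> p k h" and "f = 0 \<or> degree f < n"
  shows "inner_poly \<mu> (p n) f = 0"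
  using assms(2)
proof (induction "degree f" arbitrary: f rule: less_induct)
  case less
  show ?case
  proof (cases "f = 0")
    case True
    then show ?thesis by (simp add: inner_poly_zero_right)
  next
    case False
    define d where "d = degree f"
    define r where "r = f - smult (lead_coeff f / k d) (p d)"
    have pd: "degree (p d) \<le> d" "coeff (p d) d = k d" "k d \<noteq> 0"
      using p by (auto simp: orthogonal_polynomials_def leading_form_iff)
    have "degree r \<le> d"
      unfolding r_def d_def
      by (intro degree_diff_le) (use pd in \<open>auto simp: d_def\<close>)
    moreover have "coeff r d = 0"
      using pd by (simp add: r_def d_def)
    ultimately have r: "r = 0 \<or> degree r < d"
      by (metis le_neq_implies_less leading_coeff_0_iff)
    have dn: "d < n"
      using less.prems False by (simp add: d_def)
    have "inner_poly \<mu> (p n) r = 0"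
    \<comment> \<open>The zero remainder is treated apart: its degree counts as 0, which is no
      decrease when \<open>d = 0\<close>.\<close>
    proof (cases "r = 0")
      case False
      then show ?thesis using r dn by (intro less.hyps) (auto simp: d_def)
    qed (simp add: inner_poly_zero_right)
    moreover have "f = r + smult (lead_coeff f / k d) (p d)"
      by (simp add: r_def)
    moreover have "inner_poly \<mu> (p n) (p d) = 0"
      using p dn by (simp add: orthogonal_polynomials_def)
    ultimately show ?thesis
      by (metis add_0 inner_poly_add_right inner_poly_smult_right mult_zero_right)
  qed
qed

lemma symmetric_triangular_op_eigenfunction:
  assumes p: "orthogonal_polynomials \<mu> p k h" and sym: "symmetric_op \<mu> T"
    and tri: "\<And>f n. degree f \<le> n \<Longrightarrow> leading_form (T f) (l n * coeff f n) n"
  shows "T (p n) = smult (l n) (p n)"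
proof -
  define q where "q = T (p n) - smult (l n) (p n)"
  have pn: "degree (p n) \<le> n"
    using p by (simp add: orthogonal_polynomials_def leading_form_iff)
  have "degree q \<le> n" "coeff q n = 0"
    using tri[OF pn] pn by (auto simp: q_def leading_form_iff intro!: degree_diff_le)
  then have q: "q = 0 \<or> degree q < n"
    by (metis le_neq_implies_less leading_coeff_0_iff)
  have "inner_poly \<mu> q q = 0"
  proof (cases "q = 0")
    case False
    with q have "degree q < n" by simp
    \<comment> \<open>Here \<open>tri\<close> is used at the degree of \<open>q\<close> itself, so
      \<open>T q\<close> also has degree below \<open>n\<close> and is orthogonal to
      \<open>p n\<close>.\<close>
    moreover have "degree (T q) \<le> degree q"
      using tri[of q "degree q"] by (simp add: leading_form_iff)
    ultimately have "inner_poly \<mu> (p n) (T q) = 0" "inner_poly \<mu> (p n) q = 0"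
      by (auto intro: orthogonal_lower_degree[OF p])
    moreover have "inner_poly \<mu> (T (p n)) q = inner_poly \<mu> (p n) (T q)"
      using sym by (simp add: symmetric_op_def)
    moreover have "inner_poly \<mu> q q = inner_poly \<mu> (T (p n)) q - l n * inner_poly \<mu> (p n) q"
      by (subst q_def) (simp only: inner_poly_diff_left inner_poly_smult_left)
    ultimately show ?thesis by simp
  qed (simp add: inner_poly_zero_right)
  then show ?thesis
    using inner_poly_self_eq_0D q_def by fastforce
qed

end

section \<open>Uniqueness and assembly\<close>

text \<open>The commutator with \<open>X_op\<close> determines the image of each monomial from that
  of the previous one, so only the value at 1 is free; a multiple of the identity commutes with
  \<open>X_op\<close> and absorbs the difference there.\<close>

lemma commutator_X_cancel:
  assumes S: "linear_op S" and T: "linear_op T"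
    and eq: "commutator_op S X_op = commutator_op T X_op" and one: "S 1 = T 1 + smult c 1"
  shows "S f = T f + smult c f"
proof -
  define U where "U f = T f + smult c f" for f
  have U: "linear_op U"
    unfolding linear_op_iff U_def
    by (simp add: linear_op_add[OF T] linear_op_smult[OF T] smult_add_right mult.commute)
  have "S (monom 1 n) = U (monom 1 n)" for n
  proof (induction n)
    case 0
    show ?case using one by (simp add: U_def)
  next
    case (Suc n)
    have "S (monom 1 (Suc n)) - X_op (S (monom 1 n)) = T (monom 1 (Suc n)) - X_op (T (monom 1 n))"
      using fun_cong[OF eq, of "monom 1 n"] by (simp add: commutator_op_def X_op_monom)
    then show ?case
      using Suc by (simp add: U_def X_op_add X_op_smult X_op_monom algebra_simps)
  qed
  then have "S = U"
    by (rule linear_op_eqI[OF S U])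
  then show ?thesis
    by (simp add: U_def)
qed

theorem proposition2p3:
  fixes \<mu> :: "real measure" and p :: "nat \<Rightarrow> real poly" and k h \<gamma> :: "nat \<Rightarrow> real"
    and L :: "real poly \<Rightarrow> real poly"
  assumes "orthogonality_measure \<mu>"
    and "orthogonal_polynomials \<mu> p k h"
    and "linear_op L"
    and "skew_symmetric_op \<mu> L"
    and "\<forall>n. leading_form (L (monom 1 n)) (\<gamma> n) (n + 1) \<and> \<gamma> n \<noteq> 0"
  shows "symmetric_op \<mu> (D_op L) \<and>
         (\<exists>l :: nat \<Rightarrow> real. l 0 = 0 \<and> (\<forall>n. l (n + 1) - l n = \<gamma> n \<and> \<gamma> n \<noteq> 0) \<and>
            (\<forall>n. leading_form (D_op L (monom 1 n)) (l n) n) \<and>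
            (\<forall>n. D_op L (p n) = smult (l n) (p n))) \<and>
         L = commutator_op (D_op L) X_op \<and>
         (\<forall>D'. linear_op D' \<and> L = commutator_op D' X_op \<and> eigenfunction_op D' 1 \<longrightarrow>
            (\<exists>c. \<forall>f. D' f = D_op L f + smult c f))"
proof -
  note \<mu> = assms(1) and p = assms(2) and L = assms(3)
  \<comment> \<open>The initial value 0 and the increments \<open>\<gamma> n\<close> force these
    partial sums.\<close>
  define l where "l n = (\<Sum>i<n. \<gamma> i)" for n
  have comm: "commutator_op (D_op L) X_op = L"
    by (rule commutator_D_op[OF L])
  have sym: "symmetric_op \<mu> (D_op L)"
    using assms(4) comm by (intro symmetric_op_if_commutator_X_skew[OF \<mu> linear_op_D_op]) simp
  have lead: "leading_form (D_monom L n) (l n) n" for n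
    unfolding l_def by (rule leading_form_D_monom) (use assms(5) in simp)
  have eig: "D_op L (p n) = smult (l n) (p n)" for n
    by (rule symmetric_triangular_op_eigenfunction[OF \<mu> p sym leading_form_D_op[OF lead]])
  have uniq: "\<exists>c. \<forall>f. D' f = D_op L f + smult c f"
    if D': "linear_op D'" "L = commutator_op D' X_op" "eigenfunction_op D' 1" for D'
  proof -
    \<comment> \<open>As \<open>D_op L\<close> annihilates 1, the eigenvalue of \<open>D'\<close> at
      1 is the constant sought.\<close>
    obtain c where "D' 1 = smult c 1"
      using D'(3) by (auto simp: eigenfunction_op_def)
    then show ?thesis
      using commutator_X_cancel[OF D'(1) linear_op_D_op[of L], of c] D'(2) comm
      by (auto simp: D_op_one)
  qed
  have "\<exists>l. l 0 = 0 \<and> (\<forall>n. l (n + 1) - l n = \<gamma> n \<and> \<gamma> n \<noteq> 0) \<and>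
      (\<forall>n. leading_form (D_op L (monom 1 n)) (l n) n) \<and> (\<forall>n. D_op L (p n) = smult (l n) (p n))"
    using assms(5) lead eig by (intro exI[of _ l]) (simp add: l_def D_op_monom_gen)
  with sym comm[symmetric] uniq show ?thesis
    by (intro conjI allI impI) auto
qed

end
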